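(* Let $m,n,n'$ be positive integers, let $\ell=\gcd(n,n')$, and let $F$ be a field whose characteristic is zero or coprime to both $n$ and $n'$. Let $g(X)=\sum_{k=0}^{n-1}g_kX^k$ and $g'(X)=\sum_{k'=0}^{n'-1}g'_{k'}X^{k'}$ be polynomials over $F$ with $\deg g(X)<n$ and $\deg g'(X)<n'$, and let $M(g,g')_{m\times(n+n')}$ be the double circulant matrix associated with $g(X)$ and $g'(X)$. Let $$d=\deg\frac{\gcd\big(g(X),\,X^n-1\big)\cdot\gcd\big(g'(X),\,X^{n'}-1\big)\cdot\big(X^\ell-1\big)}{\gcd\big(g(X)g'(X),\,X^\ell-1\big)}$$ and $r=\min\{m,\,n+n'-d\}$. Then any consecutive $r$ rows of $M(g,g')_{m\times(n+n')}$ are linearly independent.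
   Context: For a polynomial $g(X)=\sum_{j=0}^{n-1}g_jX^j$ over $F$ of degree less than $n$, the generalized circulant matrix $M(g)_{m\times n}$ is the $m\times n$ matrix over $F$ whose $i$-th row ($i=0,1,\dots,m-1$, rows counted from $0$) is $\mathcal S^i(g_0,g_1,\dots,g_{n-1})$, where $\mathcal S(a_0,a_1,\dots,a_{n-1})=(a_{n-1},a_0,\dots,a_{n-2})$ is the circular shift on $F^n$. Equivalently, its $(i,j)$ entry ($0\le i<m$, $0\le j<n$) is $g_{(j-i)\bmod n}$. The double circulant matrix associated with $g(X)$ (with $\deg g<n$) and $g'(X)$ (with $\deg g'<n'$) is the side-by-side concatenation $M(g,g')_{m\times(n+n')}=\big(M(g)_{m\times n}\,\big|\,M(g')_{m\times n'}\big)$. Here $\gcd$ of polynomials is the greatest common divisor in $F[X]$ (with $\gcd(0,f)=f$). "Consecutive $r$ rows" means rows $i,i+1,\dots,i+r-1$ for some $i$ with $0\le i\le m-r$. *)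

theory Defs
  imports
    "Jordan_Normal_Form.VS_Connect"
    "HOL-Computational_Algebra.Polynomial_Factorial"
begin

text \<open>The overloaded \<^const>\<open>gcd\<close> on polynomials needs a coefficient type of class
  \<^class>\<open>field_gcd\<close>. The following is the gcd over any type of class \<^class>\<open>field\<close>,
  normalised to be monic or zero; on \<^class>\<open>field_gcd\<close> the two agree
  (\<open>poly_gcd_eq_gcd\<close> below).\<close>

definition poly_gcd :: "'a::field poly \<Rightarrow> 'a poly \<Rightarrow> 'a poly" where
  "poly_gcd p q = (THE d. d dvd p \<and> d dvd q \<and> (\<forall>e. e dvd p \<longrightarrow> e dvd q \<longrightarrow> e dvd d) \<and>
     (d = 0 \<or> lead_coeff d = 1))"

lemma monic_dvd_antisym:
  fixes d e :: "'a::field poly"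
  assumes "d dvd e" "e dvd d" "d = 0 \<or> lead_coeff d = 1" "e = 0 \<or> lead_coeff e = 1"
  shows "d = e"
proof (cases "e = 0")
  case True
  then show ?thesis using assms by auto
next
  case False
  from assms(1) obtain k where k: "e = d * k" by (rule dvdE)
  with False have nz: "d \<noteq> 0" "k \<noteq> 0" by auto
  have "d * k dvd d * 1" using assms(2) k by simp
  then have "k dvd 1" using nz(1) using dvd_times_left_cancel_iff[of d k 1] by blast
  then obtain c where c: "k = [:c:]" by (elim is_unit_polyE)
  have "lead_coeff e = lead_coeff d * lead_coeff k" by (simp only: k lead_coeff_mult)
  then have "c = 1" using assms(3,4) nz(1) False c by simp
  then show ?thesis using k c by simp
qed

lemma poly_gcd_exists:
  fixes p q :: "'a::field poly"
  shows "\<exists>d. d dvd p \<and> d dvd q \<and> (\<forall>e. e dvd p \<longrightarrow> e dvd q \<longrightarrow> e dvd d) \<and>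
     (d = 0 \<or> lead_coeff d = 1)"
proof -
  have "\<exists>d. d dvd p \<and> d dvd q \<and> (\<forall>e. e dvd p \<longrightarrow> e dvd q \<longrightarrow> e dvd d)" for p q :: "'a poly"
  proof (induction "euclidean_size q" arbitrary: p q rule: less_induct)
    case less
    show ?case
    proof (cases "q = 0")
      case True
      then show ?thesis by (intro exI[of _ p]) auto
    next
      case False
      then have "euclidean_size (p mod q) < euclidean_size q"
        by (rule mod_size_less)
      from less[OF this, of q] obtain d where d: "d dvd q" "d dvd p mod q"
        "\<And>e. e dvd q \<Longrightarrow> e dvd p mod q \<Longrightarrow> e dvd d" by blast
      then show ?thesis
        by (intro exI[of _ d]) (auto simp: dvd_mod_iff dvd_mod)
    qed
  qed
  then obtain d where d: "d dvd p" "d dvd q" "\<And>e. e dvd p \<Longrightarrow> e dvd q \<Longrightarrow> e dvd d"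
    by blast
  show ?thesis
  proof (cases "d = 0")
    case True
    then show ?thesis using d by blast
  next
    case False
    then have "inverse (lead_coeff d) \<noteq> 0" by simp
    then show ?thesis using d False
      by (intro exI[of _ "Polynomial.smult (inverse (lead_coeff d)) d"])
        (auto simp: smult_dvd_iff dvd_smult_iff)
  qed
qed

lemma poly_gcd_props:
  fixes p q :: "'a::field poly"
  shows poly_gcd_dvd1: "poly_gcd p q dvd p"
    and poly_gcd_dvd2: "poly_gcd p q dvd q"
    and poly_gcd_greatest: "\<And>e. e dvd p \<Longrightarrow> e dvd q \<Longrightarrow> e dvd poly_gcd p q"
    and poly_gcd_monic: "poly_gcd p q = 0 \<or> lead_coeff (poly_gcd p q) = 1"
proof -
  have "\<exists>!d. d dvd p \<and> d dvd q \<and> (\<forall>e. e dvd p \<longrightarrow> e dvd q \<longrightarrow> e dvd d) \<and>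
     (d = 0 \<or> lead_coeff d = 1)"
    by (rule ex_ex1I[OF poly_gcd_exists]) (blast intro: monic_dvd_antisym)
  from theI'[OF this, folded poly_gcd_def]
  show "poly_gcd p q dvd p" "poly_gcd p q dvd q"
    "\<And>e. e dvd p \<Longrightarrow> e dvd q \<Longrightarrow> e dvd poly_gcd p q"
    "poly_gcd p q = 0 \<or> lead_coeff (poly_gcd p q) = 1" by blast+
qed

lemma poly_gcd_eq_gcd:
  fixes p q :: "'a::field_gcd poly"
  shows "poly_gcd p q = gcd p q"
proof (rule monic_dvd_antisym)
  show "gcd p q = 0 \<or> lead_coeff (gcd p q) = 1"
  proof (cases "gcd p q = 0")
    case False
    then have "unit_factor (gcd p q) = 1" by (simp only: unit_factor_gcd) auto
    then have "unit_factor (lead_coeff (gcd p q)) = 1"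
      by (simp add: unit_factor_poly_def one_pCons)
    moreover have "is_unit (lead_coeff (gcd p q))" using False by (simp add: dvd_field_iff)
    ultimately show ?thesis using is_unit_unit_factor by metis
  qed simp
next
  show "poly_gcd p q = 0 \<or> lead_coeff (poly_gcd p q) = 1" by (rule poly_gcd_monic)
qed (auto intro: poly_gcd_props gcd_greatest)

definition circ_shift :: "'a vec \<Rightarrow> 'a vec" where
  "circ_shift v = vec (dim_vec v) (\<lambda>j. if j = 0 then v $ (dim_vec v - 1) else v $ (j - 1))"

definition gen_circulant :: "nat \<Rightarrow> nat \<Rightarrow> 'a::zero poly \<Rightarrow> 'a mat" where
  "gen_circulant m n g =
     mat_of_rows n (map (\<lambda>i. (circ_shift ^^ i) (vec n (Polynomial.coeff g))) [0..<m])"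

text \<open>The lower two blocks have no rows, so this is the side-by-side concatenation.\<close>

definition double_circulant ::
  "nat \<Rightarrow> nat \<Rightarrow> nat \<Rightarrow> 'a::zero poly \<Rightarrow> 'a poly \<Rightarrow> 'a mat" where
  "double_circulant m n n' g g' =
     four_block_mat (gen_circulant m n g) (gen_circulant m n' g') (0\<^sub>m 0 n) (0\<^sub>m 0 n')"

lemma gen_circulant_dims [simp]:
  "dim_row (gen_circulant m n g) = m" "dim_col (gen_circulant m n g) = n"
  by (simp_all add: gen_circulant_def)

lemma double_circulant_carrier [simp]:
  "double_circulant m n n' g g' \<in> carrier_mat m (n + n')"
  by (simp add: double_circulant_def carrier_matI)

lemma dim_circ_shift_funpow [simp]: "dim_vec ((circ_shift ^^ i) v) = dim_vec v"
  by (induction i) (simp_all add: circ_shift_def)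

lemma circ_shift_funpow_index:
  assumes "j < dim_vec v"
  shows "(circ_shift ^^ i) v $ j = v $ nat ((int j - int i) mod int (dim_vec v))"
  using assms
proof (induction i arbitrary: j)
  case 0
  then show ?case by simp
next
  case (Suc i)
  let ?n = "dim_vec v"
  have "(circ_shift ^^ Suc i) v $ j =
      (if j = 0 then (circ_shift ^^ i) v $ (?n - 1) else (circ_shift ^^ i) v $ (j - 1))"
    using Suc.prems by (simp add: circ_shift_def)
  also have "\<dots> = v $ nat ((int j - int (Suc i)) mod int ?n)"
  proof (cases "j = 0")
    case True
    have "(int (?n - 1) - int i) mod int ?n = (int j - int (Suc i) + int ?n) mod int ?n"
      using Suc.prems True by (simp add: of_nat_diff algebra_simps)
    then show ?thesis using Suc True by simp
  next
    case False
    then have "int (j - 1) - int i = int j - int (Suc i)" by simp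
    moreover have "j - 1 < ?n" using Suc.prems by simp
    ultimately show ?thesis using Suc.IH[of "j - 1"] False by (simp only: if_False)
  qed
  finally show ?case .
qed

lemma gen_circulant_index:
  assumes "i < m" "j < n"
  shows "gen_circulant m n g $$ (i, j) = Polynomial.coeff g (nat ((int j - int i) mod int n))"
  using assms by (simp add: gen_circulant_def mat_of_rows_def circ_shift_funpow_index nat_less_iff)

lemma double_circulant_index:
  assumes "i < m" "j < n + n'"
  shows "double_circulant m n n' g g' $$ (i, j) =
    (if j < n then Polynomial.coeff g (nat ((int j - int i) mod int n))
     else Polynomial.coeff g' (nat ((int (j - n) - int i) mod int n')))"
  using assms by (simp add: double_circulant_def gen_circulant_index)

text \<open>The library notion concerns sets of vectors; distinctness makes this linear
  independence of the family, in which no vector may be repeated.\<close>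

definition lin_indpt_vecs :: "nat \<Rightarrow> 'a::field vec list \<Rightarrow> bool" where
  "lin_indpt_vecs N vs \<longleftrightarrow> distinct vs \<and> set vs \<subseteq> carrier_vec N \<and>
     \<not> module.lin_dep class_ring (module_vec TYPE('a) N) (set vs)"

end

theory Submission
  imports Defs
begin

text \<open>
  A linear relation with coefficients \<open>c\<^sub>0, c\<^sub>1, \<dots>\<close> between consecutive rows of the double circulant
  matrix is encoded by a polynomial $C = \sum_k c_k X^k$.  Shifting a row corresponds to multiplying by $X$
  modulo $X^n - 1$ (modulo $X^{n'} - 1$ in the second block), and $X$ is invertible for these moduli.
  Hence $C$ gives a relation exactly when $X^n - 1 \mid C g$ and $X^{n'} - 1 \mid C g'$.

  Put $h = (X^n - 1) / \gcd(g, X^n - 1)$ and $h' = (X^{n'} - 1) / \gcd(g', X^{n'} - 1)$.  The two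
  conditions say that $C$ is a common multiple of $h$ and $h'$, so a nonzero $C$ has degree at least
  $\deg h + \deg h' - \deg \gcd(h, h')$.

  It remains to bound $\gcd(h, h')$.  It divides both $X^n - 1$ and $X^{n'} - 1$, hence
  $X^\ell - 1$.  The hypothesis on the characteristic makes $X^n - 1$ and $X^{n'} - 1$ squarefree,
  so $h$ is coprime to $g$ and $h'$ to $g'$.  Therefore $\gcd(h, h')$ is coprime to $g g'$, and it
  divides $(X^\ell - 1) / \gcd(g g', X^\ell - 1)$.  By the degrees of these polynomials, a nonzero
  $C$ has degree at least $n + n' - d \ge r$, whereas a relation between $r$ rows gives a
  polynomial of degree less than $r$.
\<close>

section \<open>Divisibility of polynomials over a field\<close>

lemma poly_gcd_bezout:
  fixes p q :: "'a::field poly"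
  shows "\<exists>a b. a * p + b * q = poly_gcd p q"
proof -
  have "\<exists>a b. a * p + b * q dvd p \<and> a * p + b * q dvd q" for p q :: "'a poly"
  proof (induction "euclidean_size q" arbitrary: p q rule: less_induct)
    case less
    show ?case
    proof (cases "q = 0")
      case True
      then show ?thesis by (intro exI[of _ 1] exI[of _ 0]) simp
    next
      case False
      then have "euclidean_size (p mod q) < euclidean_size q"
        by (rule mod_size_less)
      from less[OF this, of q] obtain a b
        where ab: "a * q + b * (p mod q) dvd q" "a * q + b * (p mod q) dvd p mod q" by blast
      have "a * q + b * (p mod q) = b * p + (a - b * (p div q)) * q"
        by (simp add: minus_div_mult_eq_mod[symmetric] algebra_simps)
      then show ?thesis using ab by (metis dvd_mod_iff)
    qed
  qed
  then obtain a b where ab: "a * p + b * q dvd p" "a * p + b * q dvd q" by blast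
  then have "a * p + b * q dvd poly_gcd p q" by (rule poly_gcd_greatest)
  then obtain u where "poly_gcd p q = (a * p + b * q) * u" by (rule dvdE)
  then have "(u * a) * p + (u * b) * q = poly_gcd p q" by (simp add: algebra_simps)
  then show ?thesis by blast
qed

lemma coprime_poly_bezout:
  fixes p q :: "'a::field poly"
  assumes "coprime p q"
  shows "\<exists>a b. a * p + b * q = 1"
proof -
  have "is_unit (poly_gcd p q)"
    using assms poly_gcd_dvd1 poly_gcd_dvd2 by (rule coprime_common_divisor)
  then obtain u where u: "1 = poly_gcd p q * u" by (rule dvdE)
  obtain a b where "a * p + b * q = poly_gcd p q" using poly_gcd_bezout by blast
  then have "(u * a) * p + (u * b) * q = poly_gcd p q * u"
    by (metis distrib_left mult.assoc mult.commute)
  with u have "(u * a) * p + (u * b) * q = 1" by simp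
  then show ?thesis by blast
qed

lemma coprime_dvd_mult_poly:
  fixes p q s :: "'a::field poly"
  assumes "coprime p q" "p dvd q * s"
  shows "p dvd s"
proof -
  obtain a b where "a * p + b * q = 1" using coprime_poly_bezout[OF assms(1)] by blast
  then have "s = (a * p + b * q) * s" by simp
  also have "\<dots> = p * (a * s) + b * (q * s)" by (simp add: algebra_simps)
  finally show ?thesis using assms(2) by (metis dvd_add dvd_mult dvd_triv_left)
qed

lemma coprime_mult_poly:
  fixes p q s :: "'a::field poly"
  assumes "coprime p q" "coprime p s"
  shows "coprime p (q * s)"
proof (rule coprimeI)
  fix f assume f: "f dvd p" "f dvd q * s"
  have "coprime f q" using assms(1) f(1) by (meson coprime_def dvd_trans)
  then have "f dvd s" using f(2) by (rule coprime_dvd_mult_poly)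
  with f(1) assms(2) show "is_unit f" by (metis coprime_common_divisor)
qed

text \<open>A common factor \<open>f\<close> of \<open>g\<close> and \<open>h\<close> already divides \<open>gcd g M\<close>, so \<open>f\<close> occurs twice in \<open>M\<close>.\<close>

lemma coprime_cofactor_poly_gcd:
  fixes g M h :: "'a::field poly"
  assumes sqf: "\<And>f. f * f dvd M \<Longrightarrow> is_unit f"
    and h: "M = poly_gcd g M * h"
  shows "coprime h g"
proof (rule coprimeI)
  fix f assume f: "f dvd h" "f dvd g"
  then have "f dvd M" using h by (metis dvd_mult)
  with f(2) have "f dvd poly_gcd g M" by (rule poly_gcd_greatest)
  then have "f * f dvd poly_gcd g M * h" using f(1) by (rule mult_dvd_mono)
  then show "is_unit f" using sqf h by metis
qed

text \<open>With \<open>G = gcd g M\<close>, Bezout's identity writes \<open>G C\<close> as a combination of \<open>C g\<close> and \<open>M\<close>, so that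
  \<open>M = G h\<close> divides it and \<open>G\<close> can be cancelled.\<close>

lemma cofactor_poly_gcd_dvd:
  fixes g M h C :: "'a::field poly"
  assumes h: "M = poly_gcd g M * h" and M: "M \<noteq> 0" and dvd: "M dvd C * g"
  shows "h dvd C"
proof -
  obtain a b where ab: "a * g + b * M = poly_gcd g M" using poly_gcd_bezout by blast
  have "poly_gcd g M * C = a * (C * g) + (b * C) * M"
    by (simp add: ab[symmetric] algebra_simps)
  then have "M dvd poly_gcd g M * C" using dvd by simp
  then have "poly_gcd g M * h dvd poly_gcd g M * C" using h by metis
  moreover have "poly_gcd g M \<noteq> 0" using h M by auto
  ultimately show ?thesis by simp
qed

text \<open>This replaces the formula \<open>lcm h h' = h h' / gcd h h'\<close>: a divisibility by the least common
  multiple, with the denominator multiplied out.  Bezout's identity reduces it to \<open>h C\<close> and \<open>C h'\<close>,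
  each of which is divisible by \<open>h h'\<close>.\<close>

lemma mult_dvd_common_multiple:
  fixes h h' C D :: "'a::field poly"
  assumes "h dvd C" "h' dvd C" "poly_gcd h h' dvd D"
  shows "h * h' dvd D * C"
proof -
  obtain a b where ab: "a * h + b * h' = poly_gcd h h'" using poly_gcd_bezout by blast
  have "h * h' dvd h * C" "h * h' dvd C * h'"
    using assms by (simp_all add: mult_dvd_mono)
  then have "h * h' dvd a * (h * C) + b * (C * h')" by simp
  also have "a * (h * C) + b * (C * h') = poly_gcd h h' * C"
    by (simp add: ab[symmetric] algebra_simps)
  also have "\<dots> dvd D * C" using assms(3) by simp
  finally show ?thesis .
qed

section \<open>The polynomials \<open>X ^ n - 1\<close>\<close>

lemma degree_monom_minus_1:
  assumes "n > 0"
  shows "Polynomial.degree (Polynomial.monom 1 n - 1 :: 'a::field poly) = n"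
proof (rule antisym)
  show "Polynomial.degree (Polynomial.monom 1 n - 1 :: 'a poly) \<le> n"
    by (rule degree_diff_le) (simp_all add: degree_monom_le)
  show "n \<le> Polynomial.degree (Polynomial.monom 1 n - 1 :: 'a poly)"
    using assms by (intro le_degree) simp
qed

lemma monom_minus_1_neq_0:
  "n > 0 \<Longrightarrow> Polynomial.monom 1 n - 1 \<noteq> (0 :: 'a::field poly)"
  using degree_monom_minus_1[of n, where 'a='a] by auto

lemma monom_minus_1_dvd_monom_mult_minus_1:
  "Polynomial.monom 1 n - 1 dvd (Polynomial.monom 1 (n * k) - 1 :: 'a::field poly)"
proof -
  have "Polynomial.monom 1 (n * k) = (Polynomial.monom 1 n :: 'a poly) ^ k"
    by (simp add: monom_power)
  then show ?thesis by (simp add: power_diff_1_eq)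
qed

text \<open>A Bezout relation \<open>n x = n' y + gcd n n'\<close> gives
  $X^{nx} - X^{n'y} = X^{n'y}(X^\ell - 1)$ with $\ell = \gcd(n, n')$, and modulo a common divisor
  both powers on the left are \<open>1\<close>.\<close>

lemma dvd_monom_gcd_minus_1:
  fixes e :: "'a::field poly"
  assumes "n > 0" "e dvd Polynomial.monom 1 n - 1" "e dvd Polynomial.monom 1 n' - 1"
  shows "e dvd Polynomial.monom 1 (gcd n n') - 1"
proof -
  obtain x y where xy: "n * x = n' * y + gcd n n'" using bezout_nat[of n n'] assms(1) by auto
  define L :: "'a poly" where "L = Polynomial.monom 1 (gcd n n')"
  define Y :: "'a poly" where "Y = Polynomial.monom 1 (n' * y)"
  have "e dvd Polynomial.monom 1 (n * x) - 1"
    using assms(2) monom_minus_1_dvd_monom_mult_minus_1 dvd_trans by blast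
  then have "e dvd Y * L - 1" by (simp add: xy Y_def L_def mult_monom)
  moreover have "e dvd Y - 1"
    using assms(3) monom_minus_1_dvd_monom_mult_minus_1 dvd_trans unfolding Y_def by blast
  ultimately have "e dvd (Y * L - 1) - (Y - 1) * L" by simp
  also have "(Y * L - 1) - (Y - 1) * L = L - 1" by (simp add: algebra_simps)
  finally show ?thesis by (simp add: L_def)
qed

lemma of_nat_neq_0_if_coprime_CHAR:
  assumes "n > 0" "CHAR('a::field) = 0 \<or> coprime CHAR('a) n"
  shows "of_nat n \<noteq> (0 :: 'a)"
proof
  assume "of_nat n = (0 :: 'a)"
  then have dvd: "CHAR('a) dvd n" by (simp add: of_nat_eq_0_iff_char_dvd)
  with assms have "coprime CHAR('a) n" by auto
  with dvd have "CHAR('a) = 1" by (metis coprime_common_divisor dvd_refl nat_dvd_1_iff_1)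
  then show False by simp
qed

text \<open>A square factor would divide the derivative $n X^{n-1}$ as well, hence the nonzero constant
  $n = X \cdot n X^{n-1} - n (X^n - 1)$.\<close>

lemma squarefree_monom_minus_1:
  fixes f :: "'a::field poly"
  assumes "n > 0" "of_nat n \<noteq> (0 :: 'a)" "f * f dvd Polynomial.monom 1 n - 1"
  shows "is_unit f"
proof -
  let ?M = "Polynomial.monom 1 n - 1 :: 'a poly"
  obtain k where k: "?M = f * f * k" using assms(3) by (rule dvdE)
  then have "pderiv ?M = pderiv (f * f * k)" by simp
  also have "\<dots> = f * (2 * pderiv f * k + f * pderiv k)"
    by (simp add: pderiv_mult algebra_simps)
  finally have "f dvd pderiv ?M" by simp
  moreover have "f dvd ?M" unfolding k by simp
  ultimately have "f dvd Polynomial.monom 1 1 * pderiv ?M - Polynomial.smult (of_nat n) ?M"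
    by (simp add: dvd_smult)
  also have "Polynomial.monom 1 1 * pderiv ?M - Polynomial.smult (of_nat n) ?M = [:of_nat n:]"
    using assms(1)
    by (simp add: pderiv_diff pderiv_monom mult_monom smult_diff_right smult_monom)
  finally show ?thesis using assms(2) by (metis dvd_trans is_unit_triv)
qed

text \<open>The factor \<open>X ^ i\<close> can be cancelled because it is invertible modulo $X^n - 1$, with inverse
  $X^{(n-1)i}$.\<close>

lemma monom_minus_1_dvd_cancel_monom:
  fixes p :: "'a::field poly"
  assumes "n > 0" "Polynomial.monom 1 n - 1 dvd Polynomial.monom 1 i * p"
  shows "Polynomial.monom 1 n - 1 dvd p"
proof -
  let ?M = "Polynomial.monom 1 n - 1 :: 'a poly"
  have "i + (n - 1) * i = n * i" using assms(1) by (cases n) simp_all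
  then have "Polynomial.monom 1 ((n - 1) * i) * (Polynomial.monom 1 i * p)
      = Polynomial.monom 1 (n * i) * p"
    by (simp add: mult.assoc[symmetric] mult_monom add.commute)
  then have "?M dvd Polynomial.monom 1 (n * i) * p" using assms(2) by (metis dvd_mult)
  moreover have "?M dvd (Polynomial.monom 1 (n * i) - 1) * p"
    by (simp add: monom_minus_1_dvd_monom_mult_minus_1)
  ultimately have "?M dvd Polynomial.monom 1 (n * i) * p - (Polynomial.monom 1 (n * i) - 1) * p"
    by (rule dvd_diff)
  then show ?thesis by (simp add: algebra_simps)
qed

section \<open>The degree of a polynomial that annihilates both generators\<close>

text \<open>The number \<open>n + n' - d\<close> equals \<open>deg h + deg h' - deg D\<close>, where \<open>h\<close> and \<open>h'\<close> are the annihilators of \<open>g\<close>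
  and \<open>g'\<close> and \<open>D\<close> is the cofactor of \<open>gcd (g g') (X\<^sup>l - 1)\<close> in \<open>X\<^sup>l - 1\<close>.  The bound follows because \<open>D\<close> is
  a multiple of \<open>gcd h h'\<close>.\<close>

lemma degree_annihilator_ge:
  fixes g g' C :: "'a::field poly"
  assumes n: "n > 0" and n': "n' > 0"
    and l: "l = gcd n n'"
    and char: "CHAR('a) = 0 \<or> (coprime CHAR('a) n \<and> coprime CHAR('a) n')"
    and d: "d = Polynomial.degree
           ((poly_gcd g (Polynomial.monom 1 n - 1) * poly_gcd g' (Polynomial.monom 1 n' - 1)
              * (Polynomial.monom 1 l - 1))
            div poly_gcd (g * g') (Polynomial.monom 1 l - 1))"
    and C: "Polynomial.monom 1 n - 1 dvd C * g" "Polynomial.monom 1 n' - 1 dvd C * g'"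
    and C0: "C \<noteq> 0"
  shows "n + n' \<le> d + Polynomial.degree C"
proof -
  define M :: "'a poly" where "M = Polynomial.monom 1 n - 1"
  define M' :: "'a poly" where "M' = Polynomial.monom 1 n' - 1"
  define L :: "'a poly" where "L = Polynomial.monom 1 l - 1"
  define G where "G = poly_gcd g M"
  define G' where "G' = poly_gcd g' M'"
  define K where "K = poly_gcd (g * g') L"
  have M0: "M \<noteq> 0" "M' \<noteq> 0" "L \<noteq> 0"
    unfolding M_def M'_def L_def using n n' l by (intro monom_minus_1_neq_0; simp)+
  obtain h where h: "M = G * h" unfolding G_def using poly_gcd_dvd2 by (rule dvdE)
  obtain h' where h': "M' = G' * h'" unfolding G'_def using poly_gcd_dvd2 by (rule dvdE)
  obtain D where D: "L = K * D" unfolding K_def using poly_gcd_dvd2 by (rule dvdE)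
  have nz: "G \<noteq> 0" "h \<noteq> 0" "G' \<noteq> 0" "h' \<noteq> 0" "K \<noteq> 0" "D \<noteq> 0"
    using M0 h h' D by auto
  have n0: "of_nat n \<noteq> (0 :: 'a)" "of_nat n' \<noteq> (0 :: 'a)"
    using of_nat_neq_0_if_coprime_CHAR[where 'a='a] n n' char by blast+
  have cop: "coprime h g" "coprime h' g'"
    using coprime_cofactor_poly_gcd[of M g h] coprime_cofactor_poly_gcd[of M' g' h']
      squarefree_monom_minus_1 n n' n0 h h'
    unfolding M_def M'_def G_def G'_def by blast+
  \<comment> \<open>A common divisor of the annihilators divides \<open>L = K D\<close> and is coprime to \<open>K\<close>, as \<open>K\<close> divides \<open>g g'\<close>.\<close>
  have "poly_gcd h h' dvd D"
  proof (rule coprime_dvd_mult_poly)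
    let ?e = "poly_gcd h h'"
    have e: "?e dvd h" "?e dvd h'" by (rule poly_gcd_dvd1, rule poly_gcd_dvd2)
    have "coprime ?e (g * g')"
      using cop e by (intro coprime_mult_poly) (meson coprime_def dvd_trans)+
    moreover have "K dvd g * g'" unfolding K_def by (rule poly_gcd_dvd1)
    ultimately show "coprime ?e K" by (meson coprime_def dvd_trans)
    have "?e dvd M" "?e dvd M'" using e h h' by auto
    then show "?e dvd K * D"
      unfolding D[symmetric] unfolding M_def M'_def L_def l by (rule dvd_monom_gcd_minus_1[OF n])
  qed
  moreover have "h dvd C" "h' dvd C"
    using cofactor_poly_gcd_dvd[of M g h C] cofactor_poly_gcd_dvd[of M' g' h' C] h h' M0 C
    unfolding G_def G'_def M_def M'_def by blast+
  ultimately have "h * h' dvd D * C" by (intro mult_dvd_common_multiple)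
  then have "Polynomial.degree (h * h') \<le> Polynomial.degree (D * C)"
    using nz C0 by (intro dvd_imp_degree_le) auto
  then have "Polynomial.degree h + Polynomial.degree h' \<le> Polynomial.degree D + Polynomial.degree C"
    using nz C0 by (simp add: degree_mult_eq)
  moreover have "d = Polynomial.degree G + Polynomial.degree G' + Polynomial.degree D"
  proof -
    have "G * G' * L div K = G * G' * D" using nz by (simp add: D mult.left_commute)
    then have "d = Polynomial.degree (G * G' * D)"
      unfolding d by (simp add: G_def G'_def K_def M_def M'_def L_def)
    then show ?thesis using nz by (simp add: degree_mult_eq)
  qed
  moreover have "n = Polynomial.degree G + Polynomial.degree h"
    using degree_monom_minus_1[OF n, where 'a='a] h nz by (simp add: M_def[symmetric] degree_mult_eq)
  moreover have "n' = Polynomial.degree G' + Polynomial.degree h'"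
    using degree_monom_minus_1[OF n', where 'a='a] h' nz
    by (simp add: M'_def[symmetric] degree_mult_eq)
  ultimately show ?thesis by simp
qed

section \<open>Relations between cyclic shifts\<close>

definition poly_of_entries :: "'a::comm_ring_1 vec \<Rightarrow> 'a poly" where
  "poly_of_entries v = (\<Sum>j<dim_vec v. Polynomial.monom (v $ j) j)"

lemma poly_of_entries_coeffs:
  assumes "Polynomial.degree g < n"
  shows "poly_of_entries (vec n (Polynomial.coeff g)) = g"
  using poly_as_sum_of_monoms'[of g "n - 1"] assms
  by (simp add: poly_of_entries_def lessThan_Suc_atMost[symmetric])

text \<open>Multiplication by \<open>X\<close> moves the last entry to $X^n$, whereas the cyclic shift moves it to
  $X^0$; all other entries agree.\<close>

lemma monom_1_mult_poly_of_entries: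
  fixes v :: "'a::comm_ring_1 vec"
  assumes "dim_vec v = n" "n > 0"
  shows "Polynomial.monom 1 1 * poly_of_entries v - poly_of_entries (circ_shift v)
    = Polynomial.smult (v $ (n - 1)) (Polynomial.monom 1 n - 1)"
proof -
  obtain k where k: "n = Suc k" using assms(2) gr0_conv_Suc by blast
  have "poly_of_entries (circ_shift v)
      = Polynomial.monom (v $ k) 0 + (\<Sum>j<k. Polynomial.monom (v $ j) (Suc j))"
    unfolding poly_of_entries_def using assms k
    by (simp add: circ_shift_def sum.lessThan_Suc_shift del: sum.lessThan_Suc)
  moreover have "Polynomial.monom 1 1 * poly_of_entries v
      = (\<Sum>j<k. Polynomial.monom (v $ j) (Suc j)) + Polynomial.monom (v $ k) n"
    unfolding poly_of_entries_def using assms k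
    by (simp add: sum_distrib_left mult_monom distrib_left)
  ultimately show ?thesis
    using k by (simp add: smult_diff_right smult_monom monom_0)
qed

lemma monom_minus_1_dvd_shift_diff:
  fixes v :: "'a::comm_ring_1 vec"
  assumes "dim_vec v = n" "n > 0"
  shows "Polynomial.monom 1 n - 1 dvd
    Polynomial.monom 1 i * poly_of_entries v - poly_of_entries ((circ_shift ^^ i) v)"
proof (induction i)
  case 0
  then show ?case by simp
next
  case (Suc i)
  let ?M = "Polynomial.monom 1 n - 1 :: 'a poly"
  let ?w = "(circ_shift ^^ i) v"
  have "Polynomial.monom 1 (Suc i) * poly_of_entries v - poly_of_entries (circ_shift ?w)
    = Polynomial.monom 1 1 * (Polynomial.monom 1 i * poly_of_entries v - poly_of_entries ?w)
      + (Polynomial.monom 1 1 * poly_of_entries ?w - poly_of_entries (circ_shift ?w))"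
    by (simp add: right_diff_distrib mult.assoc[symmetric] mult_monom)
  also have "?M dvd \<dots>"
  proof (rule dvd_add)
    show "?M dvd Polynomial.monom 1 1 * (Polynomial.monom 1 i * poly_of_entries v - poly_of_entries ?w)"
      using Suc.IH by (rule dvd_mult)
    show "?M dvd Polynomial.monom 1 1 * poly_of_entries ?w - poly_of_entries (circ_shift ?w)"
      using monom_1_mult_poly_of_entries[of ?w n] assms by (simp add: dvd_smult)
  qed
  finally show ?case by simp
qed

lemma smult_sum_right:
  "Polynomial.smult c (sum f A) = (\<Sum>x\<in>A. Polynomial.smult c (f x))"
  by (induction A rule: infinite_finite_induct) (simp_all add: smult_add_right)

text \<open>In polynomial terms the relation reads $X^i C g \equiv 0$ modulo $X^n - 1$, where \<open>C\<close> has the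
  coefficients of the relation.\<close>

lemma shift_relation_dvd:
  fixes g :: "'a::field poly" and c :: "nat \<Rightarrow> 'a"
  assumes n: "n > 0" and g: "Polynomial.degree g < n"
    and rel: "\<And>j. j < n \<Longrightarrow>
      (\<Sum>k<r. c k * ((circ_shift ^^ (i + k)) (vec n (Polynomial.coeff g)) $ j)) = 0"
  shows "Polynomial.monom 1 n - 1 dvd (\<Sum>k<r. Polynomial.monom (c k) k) * g"
proof (rule monom_minus_1_dvd_cancel_monom[OF n, of i])
  let ?M = "Polynomial.monom 1 n - 1 :: 'a poly"
  let ?v = "vec n (Polynomial.coeff g)"
  let ?S = "\<lambda>k. poly_of_entries ((circ_shift ^^ (i + k)) ?v)"
  have "(\<Sum>k<r. Polynomial.smult (c k) (?S k))
      = (\<Sum>j<n. \<Sum>k<r. Polynomial.monom (c k * ((circ_shift ^^ (i + k)) ?v $ j)) j)"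
    by (subst sum.swap) (simp add: poly_of_entries_def smult_sum_right smult_monom)
  also have "\<dots> = (\<Sum>j<n. Polynomial.monom (\<Sum>k<r. c k * ((circ_shift ^^ (i + k)) ?v $ j)) j)"
    by (simp add: monom_sum)
  also have "\<dots> = 0" using rel by simp
  finally have zero: "(\<Sum>k<r. Polynomial.smult (c k) (?S k)) = 0" .
  have "?M dvd (\<Sum>k<r. Polynomial.smult (c k) (Polynomial.monom 1 (i + k) * g - ?S k))"
    using monom_minus_1_dvd_shift_diff[of ?v n] n poly_of_entries_coeffs[OF g]
    by (intro dvd_sum dvd_smult) auto
  also have "\<dots> = (\<Sum>k<r. Polynomial.smult (c k) (Polynomial.monom 1 (i + k) * g))"
    using zero by (simp add: smult_diff_right sum_subtractf)
  also have "\<dots> = (\<Sum>k<r. Polynomial.monom 1 i * Polynomial.monom (c k) k * g)"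
    by (intro sum.cong) (simp_all add: mult_monom smult_monom flip: mult_smult_left)
  also have "\<dots> = Polynomial.monom 1 i * ((\<Sum>k<r. Polynomial.monom (c k) k) * g)"
    by (simp add: sum_distrib_left sum_distrib_right mult.assoc)
  finally show "?M dvd Polynomial.monom 1 i * ((\<Sum>k<r. Polynomial.monom (c k) k) * g)" .
qed

section \<open>Linear independence of the rows\<close>

text \<open>Independence of the set of listed vectors concerns coefficients indexed by vectors.  A repeated
  vector would give the nontrivial relation with coefficients \<open>1\<close> and \<open>-1\<close>, so coefficients can be
  indexed by positions instead.\<close>

lemma lin_indpt_vecsI:
  fixes vs :: "'a::field vec list"
  assumes carrier: "set vs \<subseteq> carrier_vec N"
    and indep: "\<And>c k. (\<And>j. j < N \<Longrightarrow> (\<Sum>k<length vs. c k * (vs ! k $ j)) = 0) \<Longrightarrow>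
      k < length vs \<Longrightarrow> c k = 0"
  shows "lin_indpt_vecs N vs"
proof -
  have dist: "distinct vs"
  proof (rule ccontr)
    assume "\<not> distinct vs"
    then obtain a b where ab: "a < length vs" "b < length vs" "a \<noteq> b" "vs ! a = vs ! b"
      by (auto simp: distinct_conv_nth)
    define c :: "nat \<Rightarrow> 'a" where "c k = (if k = a then 1 else 0) - (if k = b then 1 else 0)" for k
    have "(\<Sum>k<length vs. c k * (vs ! k $ j)) = 0" for j
      using ab by (simp add: c_def left_diff_distrib sum_subtractf if_distrib[of "\<lambda>x. x * _"]
          sum.delta cong: if_cong)
    then have "c a = 0" using indep ab(1) by blast
    then show False using ab(3) by (simp add: c_def)
  qed
  interpret vec_space "TYPE('a)" N .
  have "lin_indpt (set vs)"
  proof (rule finite_lin_indpt2)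
    fix a :: "'a vec \<Rightarrow> 'a"
    assume lc: "lincomb a (set vs) = 0\<^sub>v N"
    have "(\<Sum>k<length vs. a (vs ! k) * (vs ! k $ j)) = 0" if j: "j < N" for j
    proof -
      have "(\<Sum>k<length vs. a (vs ! k) * (vs ! k $ j)) = (\<Sum>v\<in>set vs. a v * v $ j)"
        by (rule sum.reindex_bij_betw[OF bij_betw_nth[OF dist refl refl]])
      also have "\<dots> = lincomb a (set vs) $ j"
        using lincomb_index[OF j carrier] by simp
      finally show ?thesis using lc j by simp
    qed
    then have "a (vs ! k) = 0" if "k < length vs" for k
      using indep[of "\<lambda>k. a (vs ! k)"] that by blast
    then show "\<forall>v\<in>set vs. a v = 0"
      by (auto simp: in_set_conv_nth)
  qed (use carrier in auto)
  then show ?thesis using dist carrier by (simp add: lin_indpt_vecs_def)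
qed

lemma row_gen_circulant:
  assumes "i < m"
  shows "row (gen_circulant m n g) i = (circ_shift ^^ i) (vec n (Polynomial.coeff g))"
  using assms unfolding gen_circulant_def
  by (subst mat_of_rows_row) (auto intro: carrier_vecI)

lemma row_double_circulant:
  assumes "i < m"
  shows "row (double_circulant m n n' g g') i
    = (circ_shift ^^ i) (vec n (Polynomial.coeff g)) @\<^sub>v
      (circ_shift ^^ i) (vec n' (Polynomial.coeff g'))"
  using assms unfolding double_circulant_def
  by (subst row_four_block_mat(1)[of _ m n _ n' _ 0]) (auto intro: carrier_matI simp: row_gen_circulant)

theorem corollary3p7:
  fixes m n n' l d r :: nat
    and g g' :: "'a::field poly"
  assumes "m > 0" and "n > 0" and "n' > 0"
    and "l = gcd n n'"
    and "CHAR('a) = 0 \<or> (coprime CHAR('a) n \<and> coprime CHAR('a) n')"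
    and "Polynomial.degree g < n" and "Polynomial.degree g' < n'"
    and "d = Polynomial.degree
           ((poly_gcd g (Polynomial.monom 1 n - 1) * poly_gcd g' (Polynomial.monom 1 n' - 1)
              * (Polynomial.monom 1 l - 1))
            div poly_gcd (g * g') (Polynomial.monom 1 l - 1))"
    and "r = min m (n + n' - d)"
  shows "\<forall>i. i + r \<le> m \<longrightarrow>
    lin_indpt_vecs (n + n') (map (row (double_circulant m n n' g g')) [i..<i + r])"
proof (intro allI impI)
  fix i assume i: "i + r \<le> m"
  let ?rows = "map (row (double_circulant m n n' g g')) [i..<i + r]"
  show "lin_indpt_vecs (n + n') ?rows"
  proof (rule lin_indpt_vecsI)
    have "row (double_circulant m n n' g g') k \<in> carrier_vec (n + n')" for k
      by (rule carrier_vecI) (simp add: carrier_matD(2)[OF double_circulant_carrier])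
    then show "set ?rows \<subseteq> carrier_vec (n + n')" by auto
    fix c k
    assume rel: "\<And>j. j < n + n' \<Longrightarrow> (\<Sum>k<length ?rows. c k * (?rows ! k $ j)) = 0"
      and k: "k < length ?rows"
    let ?s = "\<lambda>k. (circ_shift ^^ (i + k)) (vec n (Polynomial.coeff g))"
    let ?s' = "\<lambda>k. (circ_shift ^^ (i + k)) (vec n' (Polynomial.coeff g'))"
    have rows: "?rows ! k = ?s k @\<^sub>v ?s' k" if "k < r" for k
      using that i by (simp add: row_double_circulant)
    define C where "C = (\<Sum>k<r. Polynomial.monom (c k) k)"
    have coeff_C: "Polynomial.coeff C k = (if k < r then c k else 0)" for k
      by (simp add: C_def coeff_sum sum.delta)
    have "(\<Sum>k<r. c k * (?s k $ j)) = 0" if "j < n" for j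
      using rel[of j] that rows by simp
    then have C1: "Polynomial.monom 1 n - 1 dvd C * g"
      unfolding C_def using assms(2,6) by (rule shift_relation_dvd[rotated 2])
    have "(\<Sum>k<r. c k * (?s' k $ j)) = 0" if "j < n'" for j
      using rel[of "n + j"] that rows by simp
    then have C2: "Polynomial.monom 1 n' - 1 dvd C * g'"
      unfolding C_def using assms(3,7) by (rule shift_relation_dvd[rotated 2])
    have "C = 0"
    proof (rule ccontr)
      assume "C \<noteq> 0"
      then have "n + n' \<le> d + Polynomial.degree C"
        using degree_annihilator_ge[OF assms(2,3,4,5,8) C1 C2] by simp
      moreover have "Polynomial.degree C < r"
        using coeff_C \<open>C \<noteq> 0\<close> by (metis leading_coeff_0_iff)
      then have "Polynomial.degree C + d < n + n'"
        using assms(9) by (simp add: less_diff_conv)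
      ultimately show False by linarith
    qed
    then show "c k = 0" using coeff_C[of k] k by simp
  qed
qed

end
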